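(* Let $D$ be an $\mathrm{STS}_2(v)$ on $\mathbb{F}_2^v$ with an automorphism $A$ of order $3$. Then $A$ has type $A_{v,f}$ with $f\not\equiv 2\pmod 3$. If $f\not\equiv v\pmod 3$, then either $v=3$ or $f\le (v-3)/2$.
   Context: An $\mathrm{STS}_2(v)$ on $V=\mathbb{F}_2^v$ is a set of $3$-dimensional subspaces (blocks) of $V$ such that every $2$-dimensional subspace lies in exactly one block. $\mathrm{GL}(v,2)$ acts on subspaces via $\mathbf{x}\mapsto\mathbf{x}A$; an automorphism of $D$ is an $A\in\mathrm{GL}(v,2)$ mapping $D$ to itself. For $f\in\{0,\ldots,v-1\}$ with $v-f$ even, $A_{v,f}$ is the block-diagonal matrix consisting of $\frac{v-f}{2}$ blocks $\begin{pmatrix}0&1\\1&1\end{pmatrix}$ followed by $I_f$; every element of order $3$ in $\mathrm{GL}(v,2)$ is conjugate to exactly one $A_{v,f}$, called its type. *)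

theory Defs
  imports Complex_Main "HOL-Library.Z2" "HOL-Algebra.Multiplicative_Group"
    "Jordan_Normal_Form.VS_Connect"
begin

abbreviation F2_space :: "nat \<Rightarrow> (bit, bit vec) module" where
  "F2_space v \<equiv> module_vec TYPE(bit) v"

definition subspaces_of_dim :: "nat \<Rightarrow> nat \<Rightarrow> bit vec set set" where
  "subspaces_of_dim v k =
     {W. VectorSpace.subspace class_ring W (F2_space v) \<and>
         vectorspace.dim class_ring ((F2_space v)\<lparr>carrier := W\<rparr>) = k}"

definition STS2 :: "nat \<Rightarrow> bit vec set set \<Rightarrow> bool" where
  "STS2 v D \<longleftrightarrow> D \<subseteq> subspaces_of_dim v 3 \<and>
     (\<forall>L \<in> subspaces_of_dim v 2. \<exists>!B. B \<in> D \<and> L \<subseteq> B)"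

definition GL2 :: "nat \<Rightarrow> bit mat monoid" where
  "GL2 v = units_of (ring_mat TYPE(bit) v ())"

text \<open>Vectors are rows: the product \<open>x A\<close> is the transpose of \<open>A\<^sup>T x\<^sup>T\<close>, and
  \<open>bit vec\<close> does not distinguish rows from columns.\<close>

definition row_mult :: "bit vec \<Rightarrow> bit mat \<Rightarrow> bit vec" where
  "row_mult x A = transpose_mat A *\<^sub>v x"

definition act :: "bit mat \<Rightarrow> bit vec set \<Rightarrow> bit vec set" where
  "act A W = (\<lambda>x. row_mult x A) ` W"

definition automorphism :: "nat \<Rightarrow> bit vec set set \<Rightarrow> bit mat \<Rightarrow> bool" where
  "automorphism v D A \<longleftrightarrow> A \<in> carrier (GL2 v) \<and> act A ` D = D"

definition type_mat :: "nat \<Rightarrow> nat \<Rightarrow> bit mat" where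
  "type_mat v f = diag_block_mat
     (replicate ((v - f) div 2) (mat_of_rows_list 2 [[0, 1], [1, 1]]) @ [1\<^sub>m f])"

text \<open>\<^const>\<open>similar_mat\<close> is conjugacy by an invertible matrix.\<close>

definition has_type :: "nat \<Rightarrow> bit mat \<Rightarrow> nat \<Rightarrow> bool" where
  "has_type v A f \<longleftrightarrow> f < v \<and> even (v - f) \<and> similar_mat A (type_mat v f)"

end

theory Submission
  imports Defs
begin

text \<open>
  Let \<open>F\<close> be the fixed space of the automorphism \<open>s\<close> of order 3, of dimension \<open>f\<close>. A block through
  two points of \<open>F\<close> is invariant and contains a pointwise fixed line, so it lies in \<open>F\<close>. The blocks
  inside \<open>F\<close> therefore partition the ordered pairs of points of \<open>F\<close>, whence 42 divides
  \<open>(2^f - 1) (2^f - 2)\<close>, which fails modulo 7 if \<open>f mod 3 = 2\<close>.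

  For a point \<open>p\<close> of \<open>F\<close>, the blocks through \<open>p\<close> not contained in \<open>F\<close> cut \<open>V - F\<close> into sets of size 6.
  If none of them is invariant, their number is a multiple of 3, so \<open>18\<close> divides \<open>2^v - 2^f\<close> and
  \<open>v mod 3 = f mod 3\<close>. Otherwise each of the \<open>2^f - 1\<close> points \<open>p\<close> has an invariant block, and these
  blocks contain pairwise disjoint orbits \<open>{u, s u, s (s u)}\<close> in the kernel \<open>U\<close> of \<open>1 + s + s\<^sup>2\<close>, which
  has \<open>2^(v - f)\<close> elements. Hence \<open>3 (2^f - 1) \<le> 2^(v - f) - 1\<close>; as \<open>v\<close> is odd, the bound follows.

  The normal form comes from choosing a basis of \<open>F\<close> and extending it greedily by pairs \<open>u, s u\<close>
  with \<open>u\<close> in \<open>U\<close>.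
\<close>

section \<open>Subspaces over the field with two elements\<close>

lemma UNIV_bit: "(UNIV :: bit set) = {0, 1}"
  by (auto intro: bit.exhaust)

text \<open>A finite basis \<open>b\<close> assigns to each vector exactly one coefficient function
  on \<open>b\<close>, and there are \<open>2 ^ card b\<close> such functions.\<close>

lemma card_vectorspace_bit:
  assumes "vectorspace (class_ring :: bit ring) W" "finite (carrier W)"
  shows "card (carrier W) = 2 ^ vectorspace.dim class_ring W"
proof -
  interpret W: vectorspace "class_ring :: bit ring" W by fact
  have "W.fin_dim" unfolding W.fin_dim_def
    using assms(2) W.in_own_span[OF subset_refl] W.span_is_subset2[OF subset_refl] by blast
  then obtain b where b: "finite b" "W.basis b" using W.finite_basis_exists by blast
  have bc: "b \<subseteq> carrier W" using b(2) unfolding W.basis_def by blast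
  have *: "\<forall>x. x \<in> carrier W \<longrightarrow> (\<exists>!a. a \<in> b \<rightarrow>\<^sub>E (UNIV :: bit set) \<and> W.lincomb a b = x)"
    using W.basis_criterion[OF b(1) bc] b(2) by simp
  have "bij_betw (\<lambda>a. W.lincomb a b) (b \<rightarrow>\<^sub>E (UNIV :: bit set)) (carrier W)"
  proof (rule bij_betw_imageI)
    have cl: "W.lincomb a b \<in> carrier W" for a
      by (rule W.lincomb_closed[OF bc]) simp
    show "inj_on (\<lambda>a. W.lincomb a b) (b \<rightarrow>\<^sub>E (UNIV :: bit set))"
      using * cl by (intro inj_onI) metis
    show "(\<lambda>a. W.lincomb a b) ` (b \<rightarrow>\<^sub>E UNIV) = carrier W"
      using * cl by (auto simp: image_iff)
  qed
  then have "card (carrier W) = card (b \<rightarrow>\<^sub>E (UNIV :: bit set))"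
    by (simp add: bij_betw_same_card)
  also have "\<dots> = 2 ^ card b"
    using b(1) by (simp add: card_PiE UNIV_bit numeral_2_eq_2)
  finally show ?thesis using W.dim_basis[OF b] by simp
qed

lemma finite_carrier_vec_bit: "finite (carrier_vec n :: bit vec set)"
proof -
  have "carrier_vec n \<subseteq> vec_of_list ` {xs. set xs \<subseteq> (UNIV :: bit set) \<and> length xs = n}"
  proof
    fix x :: "bit vec" assume "x \<in> carrier_vec n"
    then show "x \<in> vec_of_list ` {xs. set xs \<subseteq> (UNIV :: bit set) \<and> length xs = n}"
      by (intro image_eqI[of _ _ "list_of_vec x"]) (auto simp: vec_list)
  qed
  then show ?thesis
    by (rule finite_subset) (intro finite_imageI finite_lists_length_eq, simp add: UNIV_bit)
qed

lemma card_carrier_vec_bit: "card (carrier_vec n :: bit vec set) = 2 ^ n"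
  using card_vectorspace_bit[OF vec_vs, of n] finite_carrier_vec_bit[of n] vec_space.dim_is_n[where 'a = bit and n = n]
  by (simp add: module_vec_simps)

text \<open>The only scalars are 0 and 1, so closure under scaling comes from containing zero, and
  the dimension can be read off the cardinality. From here on subspaces are handled by
  counting.\<close>

lemma subspaces_of_dim_iff:
  "W \<in> subspaces_of_dim v k \<longleftrightarrow>
     W \<subseteq> carrier_vec v \<and> 0\<^sub>v v \<in> W \<and> (\<forall>x\<in>W. \<forall>y\<in>W. x + y \<in> W) \<and> card W = 2 ^ k"
proof -
  have "VectorSpace.subspace class_ring W (F2_space v) \<longleftrightarrow>
      W \<subseteq> carrier_vec v \<and> 0\<^sub>v v \<in> W \<and> (\<forall>x\<in>W. \<forall>y\<in>W. x + y \<in> W)" (is "?S \<longleftrightarrow> ?R")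
  proof
    assume ?S
    then interpret VectorSpace.subspace class_ring W "F2_space v" .
    interpret submodule class_ring W "F2_space v" by (rule submod)
    show ?R using subset m_closed zero_closed by (auto simp: module_vec_simps)
  next
    assume R: ?R
    show ?S
    proof (intro VectorSpace.subspace.intro vec_vs submodule.intro vec_module)
      fix c :: bit and x assume "x \<in> W"
      moreover from this R have "x \<in> carrier_vec v" "0 \<cdot>\<^sub>v x = 0\<^sub>v v" by (auto intro!: eq_vecI)
      ultimately show "c \<odot>\<^bsub>F2_space v\<^esub> x \<in> W" using R by (cases c) (auto simp: module_vec_simps)
    qed (use R in \<open>auto simp: module_vec_simps\<close>)
  qed
  moreover have "card W = 2 ^ vectorspace.dim class_ring ((F2_space v)\<lparr>carrier := W\<rparr>)"
    if "VectorSpace.subspace class_ring W (F2_space v)"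
  proof -
    have "W \<subseteq> carrier_vec v" using that calculation by blast
    then have "finite W" using finite_carrier_vec_bit finite_subset by blast
    then show ?thesis
      using card_vectorspace_bit[OF vectorspace.subspace_is_vs[OF vec_vs that]] by simp
  qed
  ultimately show ?thesis unfolding subspaces_of_dim_def by auto
qed

section \<open>Vector addition in characteristic 2\<close>

lemma bit_vec_add_self:
  "x \<in> carrier_vec n \<Longrightarrow> x + x = (0\<^sub>v n :: bit vec)"
  by (intro eq_vecI) auto

lemma bit_vec_add_cancel:
  fixes x y :: "bit vec"
  assumes "x \<in> carrier_vec n" "y \<in> carrier_vec n"
  shows "x + (x + y) = y" "(y + x) + x = y" "y + (x + y) = x"
  using assms by (auto intro!: eq_vecI simp: ac_simps)

lemma bit_vec_add_eq_0_iff: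
  fixes x y :: "bit vec"
  assumes "x \<in> carrier_vec n" "y \<in> carrier_vec n"
  shows "x + y = 0\<^sub>v n \<longleftrightarrow> x = y"
  using assms by (metis bit_vec_add_cancel(1) bit_vec_add_self right_zero_vec)

lemma card_bit_line:
  fixes x y :: "bit vec"
  assumes "x \<in> carrier_vec n" "y \<in> carrier_vec n" "x \<noteq> 0\<^sub>v n" "y \<noteq> 0\<^sub>v n" "x \<noteq> y"
  shows "card {0\<^sub>v n, x, y, x + y} = 4"
proof -
  have "x + y \<noteq> 0\<^sub>v n" using assms by (simp add: bit_vec_add_eq_0_iff)
  moreover have "x + y \<noteq> x" "x + y \<noteq> y"
    using assms bit_vec_add_cancel[of x n y] bit_vec_add_cancel[of y n x] bit_vec_add_self[of x n]
      bit_vec_add_self[of y n]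
    by metis+
  ultimately show ?thesis using assms by auto
qed

text \<open>If \<open>g (g x) = x\<close>, applying \<open>g\<close> once more gives
  \<open>x = g x\<close>. So every orbit has exactly 3 elements, and the orbits partition
  \<open>X\<close>.\<close>

lemma three_dvd_card_if_free_order3:
  assumes "finite X" and g: "\<And>x. x \<in> X \<Longrightarrow> g x \<in> X" "\<And>x. x \<in> X \<Longrightarrow> g (g (g x)) = x"
    "\<And>x. x \<in> X \<Longrightarrow> g x \<noteq> x"
  shows "3 dvd card X"
proof -
  define orb where "orb x = {x, g x, g (g x)}" for x
  have orb: "orb y = orb x" if "x \<in> X" "y \<in> orb x" for x y
    using that g by (auto simp: orb_def)
  have c: "card (orb x) = 3" if "x \<in> X" for x
  proof -
    have "g x \<noteq> x" "g (g x) \<noteq> g x" "g (g x) \<noteq> x" using g that by metis+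
    then show ?thesis by (auto simp: orb_def)
  qed
  have U: "\<Union>(orb ` X) = X" using g by (auto simp: orb_def)
  have "3 * card (orb ` X) = card (\<Union>(orb ` X))"
  proof (rule card_partition)
    show "c1 \<inter> c2 = {}" if "c1 \<in> orb ` X" "c2 \<in> orb ` X" "c1 \<noteq> c2" for c1 c2
      using that orb by blast
  qed (use U c assms(1) in auto)
  then show ?thesis using U by (metis dvd_triv_left)
qed

section \<open>Linear maps of order 3\<close>

locale order3 =
  fixes v :: nat and M :: "bit mat"
  assumes M: "M \<in> carrier_mat v v" and M3: "M * M * M = 1\<^sub>m v"
begin

abbreviation s :: "bit vec \<Rightarrow> bit vec" where "s x \<equiv> M *\<^sub>v x"

definition fixed_vecs :: "bit vec set" where "fixed_vecs = {x \<in> carrier_vec v. s x = x}"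
text \<open>Here \<open>s (s x) = x + s x\<close>: \<open>s\<close> acts like a primitive cube root
  of unity in the field with four elements, and it fixes only zero.\<close>

definition trace_kernel :: "bit vec set" where "trace_kernel = {x \<in> carrier_vec v. x + s x + s (s x) = 0\<^sub>v v}"

lemma s_carrier [simp]: "x \<in> carrier_vec v \<Longrightarrow> s x \<in> carrier_vec v"
  using M by simp

lemma s_add: "x \<in> carrier_vec v \<Longrightarrow> y \<in> carrier_vec v \<Longrightarrow> s (x + y) = s x + s y"
  using M by (rule mult_add_distrib_mat_vec)

lemma s_zero [simp]: "s (0\<^sub>v v) = 0\<^sub>v v"
  using M by (intro eq_vecI) auto

lemma s3 [simp]: assumes "x \<in> carrier_vec v" shows "s (s (s x)) = x"
proof -
  have "s (s (s x)) = (M * M * M) *\<^sub>v x"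
    using assms M by (simp add: assoc_mult_mat_vec[where n\<^sub>1 = v and n\<^sub>2 = v and n\<^sub>3 = v])
  then show ?thesis using assms M3 by simp
qed

lemma s_inj: "x \<in> carrier_vec v \<Longrightarrow> y \<in> carrier_vec v \<Longrightarrow> s x = s y \<longleftrightarrow> x = y"
  by (metis s3)

lemma fixed_vecs_carrier: "x \<in> fixed_vecs \<Longrightarrow> x \<in> carrier_vec v" by (simp add: fixed_vecs_def)
lemma fixed_vecs_zero [simp]: "0\<^sub>v v \<in> fixed_vecs" by (simp add: fixed_vecs_def)
lemma fixed_vecs_add: "x \<in> fixed_vecs \<Longrightarrow> y \<in> fixed_vecs \<Longrightarrow> x + y \<in> fixed_vecs" by (simp add: fixed_vecs_def s_add)
lemma s_fixed_vecs_iff: "x \<in> carrier_vec v \<Longrightarrow> s x \<in> fixed_vecs \<longleftrightarrow> x \<in> fixed_vecs"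
  by (auto simp: fixed_vecs_def s_inj)

lemma fixed_vecs_add_iff: "x \<in> fixed_vecs \<Longrightarrow> y \<in> carrier_vec v \<Longrightarrow> y + x \<in> fixed_vecs \<longleftrightarrow> y \<in> fixed_vecs"
  by (metis fixed_vecs_add fixed_vecs_carrier bit_vec_add_cancel(2))

text \<open>The reason is \<open>(1 + s + s\<^sup>2) (1 + s) = 1 + s\<^sup>3 = 0\<close> in
  characteristic 2.\<close>

lemma add_s_in_trace_kernel: assumes x: "x \<in> carrier_vec v" shows "x + s x \<in> trace_kernel"
proof -
  have "a + b + (b + c) + (c + a) = 0\<^sub>v v"
    if "a \<in> carrier_vec v" "b \<in> carrier_vec v" "c \<in> carrier_vec v" for a b c :: "bit vec"
    using that by (auto intro!: eq_vecI)
  from this[of x "s x" "s (s x)"] show ?thesis using x by (simp add: trace_kernel_def s_add)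
qed

text \<open>The map \<open>1 + s + s\<^sup>2\<close> is the identity on \<open>fixed_vecs\<close>,
  being multiplication by 3 there, and zero on \<open>trace_kernel\<close>. So \<open>a + u\<close>
  determines \<open>a\<close> and then \<open>u\<close>.\<close>

lemma card_fixed_vecs_trace_kernel_le: "card fixed_vecs * card trace_kernel \<le> 2 ^ v"
proof -
  let ?t = "\<lambda>x. x + s x + s (s x)"
  have t: "?t (a + u) = a" if "a \<in> fixed_vecs" "u \<in> trace_kernel" for a u
  proof -
    have a: "a \<in> carrier_vec v" "s a = a" and u: "u \<in> carrier_vec v" "?t u = 0\<^sub>v v"
      using that by (auto simp: fixed_vecs_def trace_kernel_def)
    have "?t (a + u) = a + ?t u"
      using a u(1) by (auto simp: s_add intro!: eq_vecI)
    then show ?thesis using a u by simp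
  qed
  have "inj_on (\<lambda>(a, u). a + u) (fixed_vecs \<times> trace_kernel)"
  proof (rule inj_onI, clarsimp)
    fix a u b w assume h: "a \<in> fixed_vecs" "u \<in> trace_kernel" "b \<in> fixed_vecs" "w \<in> trace_kernel" "a + u = b + w"
    then have "a = b" using t by metis
    moreover from this h have "u = w"
      by (metis (no_types, lifting) fixed_vecs_carrier trace_kernel_def bit_vec_add_cancel(1) mem_Collect_eq)
    ultimately show "a = b \<and> u = w" by simp
  qed
  moreover have "(\<lambda>(a, u). a + u) ` (fixed_vecs \<times> trace_kernel) \<subseteq> carrier_vec v"
    by (auto simp: fixed_vecs_def trace_kernel_def)
  ultimately have "card (fixed_vecs \<times> trace_kernel) \<le> card (carrier_vec v :: bit vec set)"
    using card_inj_on_le finite_carrier_vec_bit by blast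
  then show ?thesis by (simp add: card_cartesian_product card_carrier_vec_bit)
qed

end

section \<open>Steiner systems with an automorphism of order 3\<close>

text \<open>Lines are replaced by pairs of distinct nonzero vectors, and dimension 3 by cardinality
  8.\<close>

locale sts_order3 = order3 +
  fixes D :: "bit vec set set"
  assumes block: "\<And>B. B \<in> D \<Longrightarrow> B \<subseteq> carrier_vec v \<and> 0\<^sub>v v \<in> B \<and> card B = 8"
    and block_add: "\<And>B x y. B \<in> D \<Longrightarrow> x \<in> B \<Longrightarrow> y \<in> B \<Longrightarrow> x + y \<in> B"
    and block_ex: "\<And>x y. x \<in> carrier_vec v \<Longrightarrow> y \<in> carrier_vec v \<Longrightarrow> x \<noteq> 0\<^sub>v v \<Longrightarrow> y \<noteq> 0\<^sub>v v \<Longrightarrow> x \<noteq> y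
      \<Longrightarrow> \<exists>B\<in>D. x \<in> B \<and> y \<in> B"
    and block_unique: "\<And>B C x y. B \<in> D \<Longrightarrow> C \<in> D \<Longrightarrow> x \<in> B \<Longrightarrow> x \<in> C \<Longrightarrow> y \<in> B \<Longrightarrow> y \<in> C
      \<Longrightarrow> x \<noteq> 0\<^sub>v v \<Longrightarrow> y \<noteq> 0\<^sub>v v \<Longrightarrow> x \<noteq> y \<Longrightarrow> B = C"
    and block_image: "\<And>B. B \<in> D \<Longrightarrow> s ` B \<in> D"
begin

lemma block_carrier: "B \<in> D \<Longrightarrow> x \<in> B \<Longrightarrow> x \<in> carrier_vec v"
  using block by auto

lemma finite_block: "B \<in> D \<Longrightarrow> finite B"
  using block by (metis card.infinite zero_neq_numeral)

lemma finite_D: "finite D"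
  using block by (intro finite_subset[of D "Pow (carrier_vec v)"]) (auto simp: finite_carrier_vec_bit)

text \<open>If \<open>z \<in> B\<close> is not fixed, then \<open>B\<close> is the disjoint union of a pointwise fixed line \<open>L\<close> and
  \<open>z + L\<close>, so \<open>s z = z + l\<close> with \<open>l \<in> L\<close>, and \<open>s (s (s z)) = z + l\<close> forces \<open>l = 0\<close>.\<close>
lemma block_through_two_fixed_points:
  assumes B: "B \<in> D" and x: "x \<in> B" "x \<in> fixed_vecs" "x \<noteq> 0\<^sub>v v" and y: "y \<in> B" "y \<in> fixed_vecs" "y \<noteq> 0\<^sub>v v"
    and xy: "x \<noteq> y"
  shows "B \<subseteq> fixed_vecs"
proof
  fix z assume z: "z \<in> B"
  define L where "L = {0\<^sub>v v, x, y, x + y}"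
  have xc: "x \<in> carrier_vec v" and yc: "y \<in> carrier_vec v" and zc: "z \<in> carrier_vec v"
    using block_carrier B x y z by auto
  have "s ` B = B"
  proof (rule block_unique[OF block_image[OF B] B])
    show "x \<in> s ` B" "y \<in> s ` B" using x y by (auto simp: fixed_vecs_def image_iff intro: bexI[of _ x] bexI[of _ y])
  qed (use x y xy in auto)
  then have szB: "s z \<in> B" using z by auto
  have LF: "L \<subseteq> fixed_vecs" using x y by (auto simp: L_def fixed_vecs_add)
  have LB: "L \<subseteq> B" using x y B block block_add by (auto simp: L_def)
  have cL: "card L = 4" unfolding L_def using x y xy xc yc by (intro card_bit_line)
  show "z \<in> fixed_vecs"
  proof (rule ccontr)
    assume nz: "z \<notin> fixed_vecs"
    have "inj_on ((+) z) L"
      using zc LF fixed_vecs_carrier by (intro inj_onI) (metis bit_vec_add_cancel(1) subsetD)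
    then have "card ((+) z ` L) = 4" using cL by (simp add: card_image)
    moreover have "L \<inter> (+) z ` L = {}" using nz zc LF fixed_vecs_add_iff by blast
    moreover have "finite L" by (simp add: L_def)
    ultimately have "card (L \<union> (+) z ` L) = 8" using cL by (simp add: card_Un_disjoint)
    moreover have "L \<union> (+) z ` L \<subseteq> B" using LB z B block_add by auto
    ultimately have "B = L \<union> (+) z ` L"
      using card_subset_eq[OF finite_block[OF B]] block[OF B] by metis
    moreover have "s z \<notin> L" using nz zc LF s_fixed_vecs_iff by blast
    ultimately obtain l where l: "l \<in> L" "s z = z + l" using szB by auto
    have lc: "l \<in> carrier_vec v" and sl: "s l = l" using l LF by (auto simp: fixed_vecs_def)
    have "s (s (s z)) = z + l" using l(2) sl lc zc by (simp add: s_add bit_vec_add_cancel)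
    then have "z + l = z" using zc by simp
    then have "s z = z" using l by simp
    then show False using nz zc by (simp add: fixed_vecs_def)
  qed
qed

lemma block_meets_fixed_vecs:
  assumes "B \<in> D" "p \<in> B" "p \<in> fixed_vecs" "p \<noteq> 0\<^sub>v v" "\<not> B \<subseteq> fixed_vecs"
  shows "B \<inter> fixed_vecs = {0\<^sub>v v, p}"
  using assms block_through_two_fixed_points[of B p] block[of B] by auto

lemma card_fixed_vecs_dvd: "42 dvd (card fixed_vecs - 1) * (card fixed_vecs - 2)"
proof -
  define pr where "pr W = {(x, y). x \<in> W - {0\<^sub>v v} \<and> y \<in> W - {0\<^sub>v v} \<and> x \<noteq> y}" for W :: "bit vec set"
  have cp: "card (pr W) = (card W - 1) * (card W - 2)" if "finite W" "0\<^sub>v v \<in> W" for W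
  proof -
    have "pr W = (SIGMA x:W - {0\<^sub>v v}. W - {0\<^sub>v v} - {x})" by (auto simp: pr_def)
    then show ?thesis using that by (simp add: numeral_2_eq_2)
  qed
  define Y where "Y = {B \<in> D. B \<subseteq> fixed_vecs}"
  have fF: "finite fixed_vecs" using finite_carrier_vec_bit[of v] by (auto simp: fixed_vecs_def)
  have U: "\<Union>(pr ` Y) = pr fixed_vecs"
  proof
    show "\<Union>(pr ` Y) \<subseteq> pr fixed_vecs" by (auto simp: pr_def Y_def)
    show "pr fixed_vecs \<subseteq> \<Union>(pr ` Y)"
    proof clarify
      fix x y assume "(x, y) \<in> pr fixed_vecs"
      then have xy: "x \<in> fixed_vecs" "y \<in> fixed_vecs" "x \<noteq> 0\<^sub>v v" "y \<noteq> 0\<^sub>v v" "x \<noteq> y" by (auto simp: pr_def)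
      then obtain B where B: "B \<in> D" "x \<in> B" "y \<in> B" using block_ex fixed_vecs_carrier by metis
      then have "B \<subseteq> fixed_vecs" using block_through_two_fixed_points xy by metis
      then show "(x, y) \<in> \<Union>(pr ` Y)" using B xy by (auto simp: pr_def Y_def)
    qed
  qed
  \<comment> \<open>A block has 7 nonzero vectors, hence 7 * 6 = 42 ordered pairs of distinct
    ones.\<close>
  have "42 * card (pr ` Y) = card (\<Union>(pr ` Y))"
  proof (rule card_partition)
    show "finite (pr ` Y)" using finite_D by (auto simp: Y_def)
    show "finite (\<Union>(pr ` Y))" unfolding U
      by (rule finite_subset[of _ "fixed_vecs \<times> fixed_vecs"]) (use fF in \<open>auto simp: pr_def\<close>)
    show "card c = 42" if "c \<in> pr ` Y" for c
      using that block finite_block by (auto simp: cp Y_def)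
    show "c1 \<inter> c2 = {}" if c: "c1 \<in> pr ` Y" "c2 \<in> pr ` Y" "c1 \<noteq> c2" for c1 c2
    proof -
      obtain B C where BC: "c1 = pr B" "c2 = pr C" "B \<in> D" "C \<in> D" "B \<noteq> C" using c by (auto simp: Y_def)
      then show ?thesis using block_unique[of B C] by (auto simp: pr_def)
    qed
  qed
  then show ?thesis unfolding U using cp[OF fF] by (metis fixed_vecs_zero dvd_triv_left)
qed

text \<open>Blocks through \<open>p\<close> that share a further nonzero vector coincide, so
  removing 0 and \<open>p\<close> leaves disjoint sets of size 6. By \<open>dich\<close> each of
  them lies in \<open>X\<close> or misses it. Used for all vectors except 0 and \<open>p\<close>,
  and for the complement of the fixed space.\<close>

lemma star_count:
  assumes p: "p \<in> carrier_vec v" "p \<noteq> 0\<^sub>v v" and X: "X \<subseteq> carrier_vec v - {0\<^sub>v v, p}"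
    and dich: "\<And>B. B \<in> D \<Longrightarrow> p \<in> B \<Longrightarrow> B \<inter> X \<noteq> {} \<Longrightarrow> B - {0\<^sub>v v, p} \<subseteq> X"
  shows "card X = 6 * card {B \<in> D. p \<in> B \<and> B \<inter> X \<noteq> {}}"
proof -
  let ?S = "{B \<in> D. p \<in> B \<and> B \<inter> X \<noteq> {}}" and ?h = "\<lambda>B. B - {0\<^sub>v v, p}"
  have U: "\<Union>(?h ` ?S) = X"
  proof
    show "X \<subseteq> \<Union>(?h ` ?S)"
    proof
      fix x assume x: "x \<in> X"
      then obtain B where "B \<in> D" "p \<in> B" "x \<in> B" using block_ex[of p x] p X by blast
      then show "x \<in> \<Union>(?h ` ?S)" using x X by blast
    qed
  qed (use dich in blast)
  have dj: "B = C" if "B \<in> ?S" "C \<in> ?S" "?h B \<inter> ?h C \<noteq> {}" for B C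
    using that block_unique[of B C p] p(2) by blast
  have c6: "card (?h B) = 6" if "B \<in> ?S" for B
    using that block finite_block p(2) by (subst card_Diff_subset) auto
  have "6 * card (?h ` ?S) = card (\<Union>(?h ` ?S))"
  proof (rule card_partition)
    show "finite (?h ` ?S)" using finite_D by auto
    show "finite (\<Union>(?h ` ?S))" unfolding U using X finite_carrier_vec_bit finite_subset by (metis finite_Diff)
    show "c1 \<inter> c2 = {}" if "c1 \<in> ?h ` ?S" "c2 \<in> ?h ` ?S" "c1 \<noteq> c2" for c1 c2
      using that dj by blast
  qed (use c6 in blast)
  moreover have "inj_on ?h ?S"
  proof (rule inj_onI)
    fix B C assume BC: "B \<in> ?S" "C \<in> ?S" "?h B = ?h C"
    have "?h B \<noteq> {}" using c6[OF BC(1)] by (metis card.empty zero_neq_numeral)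
    then show "B = C" using dj[OF BC(1,2)] BC(3) by simp
  qed
  ultimately show ?thesis unfolding U by (simp only: card_image)
qed

text \<open>The blocks through a point cut the other \<open>2 ^ v - 2\<close> vectors into sets of
  size 6, but \<open>2 ^ v = 4 ^ k\<close> is 1 modulo 3.\<close>

lemma odd_dimension: assumes "v > 0" shows "odd v"
proof
  assume "even v"
  then obtain k where k: "v = 2 * k" by auto
  have "card (carrier_vec v - {0\<^sub>v v} :: bit vec set) = 2 ^ v - 1"
    using finite_carrier_vec_bit[of v] by (simp add: card_carrier_vec_bit)
  moreover have "(2::nat) ^ v > 1" using assms by (intro one_less_power) auto
  ultimately have "carrier_vec v - {0\<^sub>v v} \<noteq> ({} :: bit vec set)" by force
  then obtain p :: "bit vec" where p: "p \<in> carrier_vec v" "p \<noteq> 0\<^sub>v v" by blast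
  have "card (carrier_vec v - {0\<^sub>v v, p}) = 6 * card {B \<in> D. p \<in> B \<and> B \<inter> (carrier_vec v - {0\<^sub>v v, p}) \<noteq> {}}"
    by (rule star_count[OF p]) (use block_carrier in auto)
  then have "6 dvd card (carrier_vec v - {0\<^sub>v v, p})" by simp
  then have "6 dvd (2 ^ v - 2 :: nat)"
    using p finite_carrier_vec_bit[of v] by (simp add: card_Diff_subset card_carrier_vec_bit numeral_2_eq_2)
  then have "6 dvd (4 ^ k - 2 :: nat)" by (simp add: k power_mult)
  then have "3 dvd (4 ^ k - 2 :: nat)" by (rule dvd_trans[rotated]) simp
  moreover have "(4::nat) ^ k mod 3 = 1" using power_mod[of "4::nat" 3 k] by simp
  moreover have "(4::nat) ^ k \<ge> 4" using k assms by (cases k) auto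
  ultimately show False by presburger
qed

lemma invariant_block_through_fixed_point:
  assumes f: "card fixed_vecs = 2 ^ f" "f \<le> v" "even (v - f)" "f mod 3 \<noteq> v mod 3"
    and p: "p \<in> fixed_vecs" "p \<noteq> 0\<^sub>v v"
  shows "\<exists>B\<in>D. p \<in> B \<and> \<not> B \<subseteq> fixed_vecs \<and> s ` B = B"
proof (rule ccontr)
  assume no: "\<not> ?thesis"
  let ?X = "carrier_vec v - fixed_vecs" and ?S = "{B \<in> D. p \<in> B \<and> B \<inter> (carrier_vec v - fixed_vecs) \<noteq> {}}"
  have S: "B \<in> ?S \<longleftrightarrow> B \<in> D \<and> p \<in> B \<and> \<not> B \<subseteq> fixed_vecs" for B using block_carrier by blast
  have pc: "p \<in> carrier_vec v" and sp: "s p = p" using p by (auto simp: fixed_vecs_def)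
  have "card ?X = 6 * card ?S"
  proof (rule star_count[OF pc p(2)])
    fix B assume B: "B \<in> D" "p \<in> B" "B \<inter> ?X \<noteq> {}"
    then have "B \<inter> fixed_vecs = {0\<^sub>v v, p}" using block_meets_fixed_vecs p by blast
    then show "B - {0\<^sub>v v, p} \<subseteq> ?X" using block_carrier B by blast
  qed (use p in auto)
  \<comment> \<open>As \<open>p\<close> is fixed, \<open>s\<close> permutes these blocks, and
    \<open>no\<close> says that none of them is mapped to itself.\<close>
  moreover have "3 dvd card ?S"
  proof (rule three_dvd_card_if_free_order3[where g = "\<lambda>B. s ` B"])
    show "finite ?S" using finite_D by auto
    fix B assume "B \<in> ?S"
    then have B: "B \<in> D" "p \<in> B" "\<not> B \<subseteq> fixed_vecs" using S by auto
    have "\<not> s ` B \<subseteq> fixed_vecs" using B s_fixed_vecs_iff block_carrier by blast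
    moreover have "p \<in> s ` B" using B(2) sp by (metis imageI)
    ultimately show "s ` B \<in> ?S" using S block_image B by blast
    show "s ` s ` s ` B = B" using block_carrier[OF B(1)] by (force simp: image_image)
    show "s ` B \<noteq> B" using no B by blast
  qed
  moreover have "card ?X = 2 ^ v - 2 ^ f"
    using finite_carrier_vec_bit[of v] f(1) by (subst card_Diff_subset) (auto simp: fixed_vecs_def card_carrier_vec_bit)
  ultimately have "18 dvd (2 ^ v - 2 ^ f :: nat)" by auto
  moreover obtain k where k: "v = f + 2 * k" using f(2,3) by (metis dvdE le_add_diff_inverse)
  moreover have "(2::nat) ^ (f + 2 * k) - 2 ^ f = 2 ^ f * (4 ^ k - 1)"
    by (simp add: power_add power_mult diff_mult_distrib2)
  ultimately have "18 dvd 2 ^ f * (4 ^ k - 1 :: nat)" by metis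
  \<comment> \<open>Only the odd part of 18 matters beside the factor \<open>2 ^ f\<close>.\<close>
  then have "9 dvd 2 ^ f * (4 ^ k - 1 :: nat)" by (rule dvd_trans[rotated]) simp
  moreover have "coprime (9::nat) (2 ^ f)"
  proof -
    have "coprime (9::nat) 2" by (simp add: coprime_iff_gcd_eq_1 gcd_non_0_nat)
    then show ?thesis by simp
  qed
  ultimately have "9 dvd (4 ^ k - 1 :: nat)" by (simp add: coprime_dvd_mult_right_iff)
  moreover have "(4::nat) ^ k \<ge> 1" by simp
  ultimately have one: "(4::nat) ^ k mod 9 = 1" by presburger
  \<comment> \<open>4 has order 3 modulo 9, so \<open>4 ^ k\<close> is 1 only if 3 divides
    \<open>k\<close>, and then \<open>v = f + 2 * k\<close> agrees with \<open>f\<close> modulo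
    3.\<close>
  have "(4::nat) ^ k mod 9 = 4 ^ (k mod 3) mod 9"
  proof -
    have "(4::nat) ^ k = (4 ^ 3) ^ (k div 3) * 4 ^ (k mod 3)"
      by (metis mult_div_mod_eq power_add power_mult)
    moreover have "((4::nat) ^ 3) ^ (k div 3) mod 9 = 1" using power_mod[of "4 ^ 3 :: nat" 9 "k div 3"] by simp
    ultimately show ?thesis by (metis mod_mult_left_eq mult_1)
  qed
  moreover have "k mod 3 = 0 \<or> k mod 3 = 1 \<or> k mod 3 = 2" by linarith
  ultimately have "k mod 3 = 0" unfolding one by (elim disjE) simp_all
  then show False using f(4) k by presburger
qed

lemma card_fixed_points_bound:
  assumes f: "card fixed_vecs = 2 ^ f" "f \<le> v" "even (v - f)" "f mod 3 \<noteq> v mod 3"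
  shows "3 * (2 ^ f - 1) \<le> (2 ^ (v - f) - 1 :: nat)"
proof -
  have "\<forall>p\<in>fixed_vecs - {0\<^sub>v v}. \<exists>B. B \<in> D \<and> p \<in> B \<and> \<not> B \<subseteq> fixed_vecs \<and> s ` B = B"
    using invariant_block_through_fixed_point[OF f] by (simp add: Bex_def)
  then obtain b where b: "\<And>p. p \<in> fixed_vecs - {0\<^sub>v v} \<Longrightarrow> b p \<in> D \<and> p \<in> b p \<and> \<not> b p \<subseteq> fixed_vecs \<and> s ` b p = b p"
    by metis
  \<comment> \<open>The witness is \<open>x + s x\<close> for a vector \<open>x\<close> of the block
    that is not fixed: it stays in the invariant block and is nonzero.\<close>
  have "\<exists>u. u \<in> b p \<and> u \<in> trace_kernel \<and> u \<noteq> 0\<^sub>v v" if p: "p \<in> fixed_vecs - {0\<^sub>v v}" for p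
  proof -
    obtain x where x: "x \<in> b p" "x \<notin> fixed_vecs" using b[OF p] by blast
    have xc: "x \<in> carrier_vec v" using x b[OF p] block_carrier by blast
    have "x + s x \<in> b p" using b[OF p] x block_add by blast
    moreover have "x + s x \<noteq> 0\<^sub>v v" using x xc by (auto simp: bit_vec_add_eq_0_iff fixed_vecs_def)
    ultimately show ?thesis using add_s_in_trace_kernel[OF xc] by blast
  qed
  then obtain u where u: "\<And>p. p \<in> fixed_vecs - {0\<^sub>v v} \<Longrightarrow> u p \<in> b p \<and> u p \<in> trace_kernel \<and> u p \<noteq> 0\<^sub>v v" by metis
  define h where "h p = {u p, s (u p), s (s (u p))}" for p
  let ?P = "fixed_vecs - {0\<^sub>v v}"
  have uc: "u p \<in> carrier_vec v" if "p \<in> ?P" for p using u[OF that] by (simp add: trace_kernel_def)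
  \<comment> \<open>Applying \<open>s\<close> to the defining equation permutes its three terms
    cyclically.\<close>
  have sU: "s w \<in> trace_kernel - {0\<^sub>v v}" if "w \<in> trace_kernel - {0\<^sub>v v}" for w
  proof -
    have w: "w \<in> carrier_vec v" "w + s w + s (s w) = 0\<^sub>v v" using that by (auto simp: trace_kernel_def)
    then have "s (w + s w + s (s w)) = 0\<^sub>v v" by simp
    then have "s w + s (s w) + s (s (s w)) = 0\<^sub>v v" using w(1) by (simp only: s_add s_carrier add_carrier_vec)
    moreover have "s w \<noteq> 0\<^sub>v v" using that w(1) s_inj[of w "0\<^sub>v v"] by auto
    ultimately show ?thesis using w by (simp add: trace_kernel_def)
  qed
  have hb: "h p \<subseteq> b p" if "p \<in> ?P" for p
    using u[OF that] b[OF that] by (auto simp: h_def)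
  have hU: "h p \<subseteq> trace_kernel - {0\<^sub>v v}" if "p \<in> ?P" for p
    using u[OF that] sU by (auto simp: h_def)
  have U0: "w = 0\<^sub>v v" if "w \<in> trace_kernel" "s w = w" for w
    using that by (auto simp: trace_kernel_def bit_vec_add_self)
  have shp: "s w \<in> h p \<and> s w \<noteq> w" if "p \<in> ?P" "w \<in> h p" for p w
    using that U0 hU[OF that(1)] uc[OF that(1)] by (auto simp: h_def)
  have c3: "card (h p) = 3" if p: "p \<in> ?P" for p
  proof -
    have "s (u p) \<noteq> u p" "s (s (u p)) \<noteq> s (u p)" "s (s (s (u p))) \<noteq> s (s (u p))"
      using shp[OF p] by (auto simp: h_def)
    then show ?thesis using uc[OF p] by (auto simp: h_def)
  qed
  \<comment> \<open>A common vector \<open>w\<close> brings along \<open>s w\<close> as a second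
    common point, so the two blocks are equal. Each meets the fixed space only in 0 and its own
    point.\<close>
  have dj: "p = q" if p: "p \<in> ?P" and q: "q \<in> ?P" and ne: "h p \<inter> h q \<noteq> {}" for p q
  proof -
    obtain w where w: "w \<in> h p" "w \<in> h q" using ne by blast
    have "w \<noteq> 0\<^sub>v v" "s w \<noteq> 0\<^sub>v v" "s w \<noteq> w" "s w \<in> h p" "s w \<in> h q"
      using w hU[OF p] shp p q by blast+
    then have "b p = b q"
      using w hb[OF p] hb[OF q] b[OF p] b[OF q] by (intro block_unique[of "b p" "b q" w "s w"]) auto
    moreover have "b r \<inter> fixed_vecs = {0\<^sub>v v, r}" if "r \<in> ?P" for r
      using b[OF that] that by (intro block_meets_fixed_vecs) auto
    note this[OF p] this[OF q]
    ultimately show "p = q" using p by auto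
  qed
  have fin: "finite fixed_vecs" "finite trace_kernel" using finite_carrier_vec_bit[of v] by (auto simp: fixed_vecs_def trace_kernel_def)
  have "3 * card ?P = card (\<Union>p\<in>?P. h p)"
  proof (subst card_UN_disjoint)
    show "\<forall>p\<in>?P. \<forall>q\<in>?P. p \<noteq> q \<longrightarrow> h p \<inter> h q = {}" using dj by blast
    show "3 * card ?P = (\<Sum>p\<in>?P. card (h p))" using c3 by simp
  qed (use fin in \<open>auto simp: h_def\<close>)
  also have "\<dots> \<le> card (trace_kernel - {0\<^sub>v v})"
    using hU fin by (intro card_mono) auto
  also have "\<dots> = card trace_kernel - 1" using fin by (simp add: trace_kernel_def)
  finally have "3 * (2 ^ f - 1) \<le> card trace_kernel - 1" using fin f(1) by simp
  moreover have "card trace_kernel \<le> 2 ^ (v - f)"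
  proof -
    have "2 ^ f * card trace_kernel \<le> 2 ^ f * 2 ^ (v - f)"
      using card_fixed_vecs_trace_kernel_le f by (simp flip: power_add)
    then show ?thesis by simp
  qed
  ultimately show ?thesis by linarith
qed

lemma fixed_dim_constraints:
  assumes f: "card fixed_vecs = 2 ^ f" "f < v" "even (v - f)"
  shows "f mod 3 \<noteq> 2" "f mod 3 \<noteq> v mod 3 \<Longrightarrow> v \<noteq> 3 \<Longrightarrow> 2 * f + 3 \<le> v"
proof -
  show "f mod 3 \<noteq> 2"
  proof
    assume "f mod 3 = 2"
    \<comment> \<open>Since 8 is 1 modulo 7, \<open>2 ^ f\<close> is 4 modulo 7, and (4 - 1) * (4 -
      2) = 6 is not divisible by 7.\<close>
    then have "(2::nat) ^ f = (2 ^ 3) ^ (f div 3) * 2 ^ 2"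
      by (metis mult_div_mod_eq power_add power_mult)
    moreover have "((2::nat) ^ 3) ^ (f div 3) mod 7 = 1" using power_mod[of "2 ^ 3 :: nat" 7 "f div 3"] by simp
    ultimately have "(2::nat) ^ f mod 7 = 4" by (simp add: mod_mult_left_eq[of "8 ^ (f div 3)" 7 4, symmetric])
    then obtain m where m: "(2::nat) ^ f = 7 * m + 4" by (metis mult_div_mod_eq)
    have "7 dvd (card fixed_vecs - 1) * (card fixed_vecs - 2)" using card_fixed_vecs_dvd by (rule dvd_trans[rotated]) simp
    moreover have "card fixed_vecs - 1 = 7 * m + 3" "card fixed_vecs - 2 = 7 * m + 2" using f(1) m by simp_all
    ultimately have "7 dvd (7 * m + 3) * (7 * m + 2)" by metis
    moreover have "(7 * m + 3) * (7 * m + 2) = 7 * (7 * m * m + 5 * m) + 6"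
      by (simp add: distrib_left distrib_right)
    ultimately have "7 dvd 7 * (7 * m * m + 5 * m) + 6" by metis
    then show False by presburger
  qed
  assume ne: "f mod 3 \<noteq> v mod 3" and v3: "v \<noteq> 3"
  have od: "odd v" using odd_dimension f by simp
  have le: "3 * (2 ^ f - 1) \<le> (2 ^ (v - f) - 1 :: nat)" using card_fixed_points_bound f ne by simp
  show "2 * f + 3 \<le> v"
  \<comment> \<open>If \<open>f < 2\<close>, then \<open>v\<close> odd and \<open>v - f\<close> even
    force \<open>f = 1\<close>, and an odd \<open>v > 1\<close> other than 3 is at least 5.\<close>
  proof (cases "f < 2")
    case True
    then show ?thesis using od v3 f by presburger
  next
    case False
    show ?thesis
    proof (rule ccontr)
      assume "\<not> ?thesis"
      \<comment> \<open>The negation gives \<open>v \<le> 2 * f + 2\<close>, improved to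
        \<open>2 * f + 1\<close> by oddness. Then \<open>3 * (2 ^ f - 1) \<le> 2 * 2 ^ f - 1\<close>
        yields \<open>2 ^ f \<le> 2\<close>, against \<open>f \<ge> 2\<close>.\<close>
      then have "v - f \<le> Suc f" using od by presburger
      then have "(2::nat) ^ (v - f) \<le> 2 * 2 ^ f" using power_increasing[of "v - f" "Suc f" "2::nat"] by simp
      moreover have "(2::nat) ^ f \<ge> 2 ^ 2" using False by (intro power_increasing) auto
      ultimately show False using le by simp
    qed
  qed
qed

end

section \<open>Normal form\<close>

lemma carrier_vec_Suc_iff: "c \<in> carrier_vec (Suc n) \<longleftrightarrow> (\<exists>a d. c = vCons a d \<and> d \<in> carrier_vec n)"
  by (cases c) (auto dest: arg_cong[of _ _ dim_vec])

lemma mat_of_cols_Cons_mult_vCons: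
  fixes b :: "'a :: comm_semiring_1 vec"
  assumes "b \<in> carrier_vec n" "c \<in> carrier_vec (length bs)"
  shows "mat_of_cols n (b # bs) *\<^sub>v vCons a c = a \<cdot>\<^sub>v b + mat_of_cols n bs *\<^sub>v c"
proof (rule eq_vecI)
  fix i assume "i < dim_vec (a \<cdot>\<^sub>v b + mat_of_cols n bs *\<^sub>v c)"
  then have i: "i < n" by simp
  have "row (mat_of_cols n (b # bs)) i = vCons (b $ i) (row (mat_of_cols n bs) i)"
    using i by (intro eq_vecI)
      (auto simp: vec_index_vCons mat_of_cols_index nth_Cons')
  then show "(mat_of_cols n (b # bs) *\<^sub>v vCons a c) $ i = (a \<cdot>\<^sub>v b + mat_of_cols n bs *\<^sub>v c) $ i"
    using i assms(1) by (simp add: mult.commute)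
qed (use assms in auto)

text \<open>As an image of the coordinate space, the span comes with explicit coordinates, and
  independence becomes \<open>card (colspan n bs) = 2 ^ length bs\<close>.\<close>

definition colspan :: "nat \<Rightarrow> bit vec list \<Rightarrow> bit vec set" where
  "colspan n bs = (\<lambda>c. mat_of_cols n bs *\<^sub>v c) ` carrier_vec (length bs)"

lemma colspan_Nil: "colspan n [] = {0\<^sub>v n}"
proof -
  have "mat_of_cols n [] *\<^sub>v c = 0\<^sub>v n" if "c \<in> carrier_vec 0" for c :: "bit vec"
    using that by (intro eq_vecI) (auto simp: scalar_prod_def)
  then show ?thesis by (auto simp: colspan_def intro: image_eqI[of _ _ "0\<^sub>v 0"])
qed

lemma colspan_carrier: "x \<in> colspan n bs \<Longrightarrow> x \<in> carrier_vec n"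
  unfolding colspan_def by (auto intro!: mult_mat_vec_carrier)

lemma colspan_Cons:
  assumes "b \<in> carrier_vec n"
  shows "colspan n (b # bs) = colspan n bs \<union> (+) b ` colspan n bs"
proof -
  have c: "mat_of_cols n bs *\<^sub>v c \<in> carrier_vec n" if "c \<in> carrier_vec (length bs)" for c
    using that by (auto intro!: mult_mat_vec_carrier)
  have z: "0 \<cdot>\<^sub>v b = 0\<^sub>v n" using assms by (intro eq_vecI) auto
  have "colspan n (b # bs) = (\<Union>a. (\<lambda>c. mat_of_cols n (b # bs) *\<^sub>v vCons a c) ` carrier_vec (length bs))"
    by (auto simp: colspan_def carrier_vec_Suc_iff) blast
  also have "\<dots> = (\<Union>a. (\<lambda>c. a \<cdot>\<^sub>v b + mat_of_cols n bs *\<^sub>v c) ` carrier_vec (length bs))"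
    by (intro SUP_cong image_cong refl mat_of_cols_Cons_mult_vCons assms)
  also have "\<dots> = colspan n bs \<union> (+) b ` colspan n bs"
    unfolding UNIV_bit using c z by (auto simp: colspan_def image_image)
  finally show ?thesis .
qed

lemma colspan_add:
  assumes "x \<in> colspan n bs" "y \<in> colspan n bs" shows "x + y \<in> colspan n bs"
proof -
  obtain c d where "c \<in> carrier_vec (length bs)" "d \<in> carrier_vec (length bs)"
    "x = mat_of_cols n bs *\<^sub>v c" "y = mat_of_cols n bs *\<^sub>v d"
    using assms by (auto simp: colspan_def)
  then have "x + y = mat_of_cols n bs *\<^sub>v (c + d)" "c + d \<in> carrier_vec (length bs)"
    by (auto simp: mult_add_distrib_mat_vec[OF mat_of_cols_carrier(1)])
  then show ?thesis by (auto simp: colspan_def)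
qed

lemma finite_colspan: "finite (colspan n bs)"
  by (simp add: colspan_def finite_carrier_vec_bit)

text \<open>The old span and its coset by \<open>b\<close> are disjoint, since otherwise
  \<open>b\<close> would be a sum of two elements of the old span.\<close>

lemma card_colspan_Cons:
  assumes b: "b \<in> carrier_vec n" "b \<notin> colspan n bs"
  shows "card (colspan n (b # bs)) = 2 * card (colspan n bs)"
proof -
  have "colspan n bs \<inter> (+) b ` colspan n bs = {}"
  proof (rule ccontr)
    assume "\<not> ?thesis"
    then obtain x where x: "x \<in> colspan n bs" "b + x \<in> colspan n bs" by auto
    have "b + x + x \<in> colspan n bs" by (rule colspan_add[OF x(2,1)])
    moreover have "b + x + x = b" using b(1) colspan_carrier[OF x(1)] by (rule bit_vec_add_cancel(2)[rotated])
    ultimately show False using b(2) by simp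
  qed
  moreover have "inj_on ((+) b) (colspan n bs)"
    using b colspan_carrier by (intro inj_onI) (metis bit_vec_add_cancel(1))
  ultimately show ?thesis
    by (simp add: colspan_Cons[OF b(1)] card_Un_disjoint finite_colspan card_image)
qed

lemma colspan_append_subset:
  "set bs \<subseteq> carrier_vec n \<Longrightarrow> colspan n cs \<subseteq> colspan n (bs @ cs)"
  by (induction bs) (auto simp: colspan_Cons)

lemma card_colspan_le:  "card (colspan n bs) \<le> 2 ^ n"
  using card_mono[OF finite_carrier_vec_bit, of "colspan n bs" n] colspan_carrier
  by (auto simp: card_carrier_vec_bit)

section \<open>The block-diagonal normal form in coordinates\<close>

text \<open>With \<open>v = 2 k + f\<close> this is \<open>type_mat v f\<close>.\<close>
definition blocks_mat :: "nat \<Rightarrow> nat \<Rightarrow> bit mat" where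
  "blocks_mat k f = diag_block_mat (replicate k (mat_of_rows_list 2 [[0, 1], [1, 1]]) @ [1\<^sub>m f])"

lemma blocks_mat_carrier [simp]: "blocks_mat k f \<in> carrier_mat (2 * k + f) (2 * k + f)"
  by (rule carrier_matI) (auto simp: blocks_mat_def dim_diag_block_mat mat_of_rows_list_def sum_list_replicate)

lemma blocks_mat_0: "blocks_mat 0 f = 1\<^sub>m f"
  unfolding blocks_mat_def replicate_0 append_Nil by (rule diag_block_mat_singleton)

lemma blocks_mat_Suc:
  "blocks_mat (Suc k) f = four_block_mat (mat_of_rows_list 2 [[0, 1], [1, 1]]) (0\<^sub>m 2 (2 * k + f))
     (0\<^sub>m (2 * k + f) 2) (blocks_mat k f)"
proof -
  have "dim_row (blocks_mat k f) = 2 * k + f" "dim_col (blocks_mat k f) = 2 * k + f"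
    using blocks_mat_carrier by blast+
  then show ?thesis
    unfolding blocks_mat_def by (simp add: Let_def mat_of_rows_list_def numeral_2_eq_2)
qed

text \<open>This symmetry transfers a normal form of \<open>transpose_mat A\<close>, which acts on
  columns, to \<open>A\<close> itself.\<close>

lemma transpose_blocks_mat: "transpose_mat (blocks_mat k f) = blocks_mat k f"
proof (induction k)
  case (Suc k)
  have KT: "transpose_mat (mat_of_rows_list 2 [[0, 1], [1, 1 :: bit]]) = mat_of_rows_list 2 [[0, 1], [1, 1]]"
    by (intro eq_matI) (auto simp: mat_of_rows_list_def less_Suc_eq numeral_2_eq_2)
  have K: "mat_of_rows_list 2 [[0, 1], [1, 1 :: bit]] \<in> carrier_mat 2 2"
    by (auto simp: mat_of_rows_list_def)
  show ?case
    unfolding blocks_mat_Suc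
    by (subst transpose_four_block_mat[OF K zero_carrier_mat zero_carrier_mat blocks_mat_carrier])
      (simp add: Suc KT)
qed (simp add: blocks_mat_0)

lemma blocks_mat_Suc_mult_vCons:
  assumes "c \<in> carrier_vec (2 * k + f)"
  shows "blocks_mat (Suc k) f *\<^sub>v vCons a (vCons b c) = vCons b (vCons (a + b) (blocks_mat k f *\<^sub>v c))"
proof -
  let ?K = "mat_of_rows_list 2 [[0, 1], [1, 1 :: bit]]"
  have K: "?K \<in> carrier_mat 2 2" by (auto simp: mat_of_rows_list_def)
  have ab: "vCons a (vCons b vNil) \<in> carrier_vec 2" by (simp add: numeral_2_eq_2)
  have "?K *\<^sub>v vCons a (vCons b vNil) = vCons b (vCons (a + b) vNil)"
    by (intro eq_vecI) (auto simp: mat_of_rows_list_def scalar_prod_def less_Suc_eq numeral_2_eq_2)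
  then show ?thesis
    using mult_mat_vec_split[OF K blocks_mat_carrier ab assms] by (simp add: blocks_mat_Suc)
qed

text \<open>A fixed vector satisfies \<open>b = a\<close> and \<open>a + b = b\<close> in each
  block, so \<open>a = b = 0\<close> and only the last \<open>f\<close> coordinates are free. This
  ties the \<open>f\<close> of a type to the size of the fixed space.\<close>

lemma card_fixed_blocks_mat:
  "card {c \<in> carrier_vec (2 * k + f). blocks_mat k f *\<^sub>v c = c} = 2 ^ f"
proof (induction k)
  case 0
  have "{c \<in> carrier_vec f. 1\<^sub>m f *\<^sub>v c = c} = (carrier_vec f :: bit vec set)" by auto
  then show ?case by (simp add: blocks_mat_0 card_carrier_vec_bit)
next
  case (Suc k)
  have "{c \<in> carrier_vec (2 * Suc k + f). blocks_mat (Suc k) f *\<^sub>v c = c} =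
    (\<lambda>c. vCons 0 (vCons 0 c)) ` {c \<in> carrier_vec (2 * k + f). blocks_mat k f *\<^sub>v c = c}" (is "?L = ?R")
  proof
    show "?R \<subseteq> ?L" by (auto simp: blocks_mat_Suc_mult_vCons)
    show "?L \<subseteq> ?R"
    proof
      fix x assume x: "x \<in> ?L"
      then obtain a b c where "x = vCons a (vCons b c)" "c \<in> carrier_vec (2 * k + f)"
        by (auto simp: carrier_vec_Suc_iff)
      moreover from this x have "b = a" "a + b = b" "blocks_mat k f *\<^sub>v c = c"
        by (auto simp: blocks_mat_Suc_mult_vCons simp del: add_bit_eq_xor)
      ultimately show "x \<in> ?R" by (cases a) auto
    qed
  qed
  then show ?case using Suc by (simp add: card_image inj_on_def)
qed

section \<open>Adapted bases and conjugation to the normal form\<close>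

context order3 begin

text \<open>On a pair, \<open>s (a u + b (s u)) = a (s u) + b (u + s u) = b u + (a + b) (s
  u)\<close>, which is the action of one block. Stated for arbitrary lists, it serves the partial
  basis as well as the complete one.\<close>

lemma s_mat_of_cols_adapted:
  assumes "set us \<subseteq> trace_kernel" "set fs \<subseteq> fixed_vecs" "c \<in> carrier_vec (2 * length us + length fs)"
  shows "s (mat_of_cols v (concat (map (\<lambda>u. [u, s u]) us) @ fs) *\<^sub>v c) =
    mat_of_cols v (concat (map (\<lambda>u. [u, s u]) us) @ fs) *\<^sub>v (blocks_mat (length us) (length fs) *\<^sub>v c)"
  using assms
proof (induction us arbitrary: c)
  case Nil
  have "s (mat_of_cols v fs *\<^sub>v c) = mat_of_cols v fs *\<^sub>v c"
    if "set fs \<subseteq> fixed_vecs" "c \<in> carrier_vec (length fs)" for c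
    using that
  proof (induction fs arbitrary: c)
    case Nil
    then have "mat_of_cols v [] *\<^sub>v c = 0\<^sub>v v" using colspan_Nil[of v] unfolding colspan_def by auto
    then show ?case by simp
  next
    case (Cons b fs)
    obtain a d where c: "c = vCons a d" "d \<in> carrier_vec (length fs)"
      using Cons.prems by (auto simp: carrier_vec_Suc_iff)
    have b: "b \<in> carrier_vec v" "s b = b" using Cons.prems by (auto simp: fixed_vecs_def)
    have "mat_of_cols v fs *\<^sub>v d \<in> carrier_vec v" using c by (auto intro!: mult_mat_vec_carrier)
    then show ?case
      using Cons.IH[OF _ c(2)] Cons.prems b c
      by (simp add: mat_of_cols_Cons_mult_vCons s_add mult_mat_vec[OF M])
  qed
  then show ?case using Nil by (simp add: blocks_mat_0)
next
  case (Cons u us)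
  let ?bs = "concat (map (\<lambda>u. [u, s u]) us) @ fs"
  have len: "length ?bs = 2 * length us + length fs"
    by (induction us) auto
  obtain a b d where c: "c = vCons a (vCons b d)" "d \<in> carrier_vec (length ?bs)"
    using Cons.prems(3) unfolding len by (auto simp: carrier_vec_Suc_iff)
  have u: "u \<in> carrier_vec v" "u + s u + s (s u) = 0\<^sub>v v" using Cons.prems by (auto simp: trace_kernel_def)
  have ssu: "s (s u) = u + s u"
    using u by (metis add_carrier_vec bit_vec_add_eq_0_iff s_carrier)
  define y where "y = blocks_mat (length us) (length fs) *\<^sub>v d"
  have yc: "y \<in> carrier_vec (length ?bs)"
    unfolding y_def len by (rule mult_mat_vec_carrier[OF blocks_mat_carrier]) (use c len in simp)
  define w where "w = mat_of_cols v ?bs *\<^sub>v y"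
  have wc: "w \<in> carrier_vec v" unfolding w_def using yc by (auto intro!: mult_mat_vec_carrier)
  have dc: "mat_of_cols v ?bs *\<^sub>v d \<in> carrier_vec v" using c by (auto intro!: mult_mat_vec_carrier)
  have "s (mat_of_cols v (u # s u # ?bs) *\<^sub>v c) = a \<cdot>\<^sub>v s u + (b \<cdot>\<^sub>v (u + s u) + w)"
    using Cons.IH[of d] Cons.prems u c dc ssu len
    by (simp add: mat_of_cols_Cons_mult_vCons s_add mult_mat_vec[OF M] w_def y_def)
  also have "\<dots> = b \<cdot>\<^sub>v u + ((a + b) \<cdot>\<^sub>v s u + w)"
    using u wc M by (cases a; cases b) (auto intro!: eq_vecI)
  also have "\<dots> = mat_of_cols v (u # s u # ?bs) *\<^sub>v (blocks_mat (Suc (length us)) (length fs) *\<^sub>v c)"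
    using c u yc len by (simp add: blocks_mat_Suc_mult_vCons mat_of_cols_Cons_mult_vCons w_def flip: y_def)
  finally show ?case by simp
qed

lemma ex_adapted_basis:
  "\<exists>us fs. set us \<subseteq> trace_kernel \<and> set fs \<subseteq> fixed_vecs \<and> 2 * length us + length fs = v \<and>
     colspan v (concat (map (\<lambda>u. [u, s u]) us) @ fs) = carrier_vec v"
proof -
  have bound: "n \<le> v" if "card (colspan v bs) = 2 ^ n" for n bs
    using card_colspan_le[of v bs] that by simp
  \<comment> \<open>A longest independent list of fixed vectors exists, as its length is at most
    \<open>v\<close>. The bound has to be strict, hence \<open>Suc v\<close>; the empty list is the
    initial witness.\<close>
  have "\<exists>fs. (set fs \<subseteq> fixed_vecs \<and> card (colspan v fs) = 2 ^ length fs) \<and>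
    (\<forall>gs. set gs \<subseteq> fixed_vecs \<and> card (colspan v gs) = 2 ^ length gs \<longrightarrow> length gs \<le> length fs)"
    by (rule ex_has_greatest_nat[where b = "Suc v" and k = "[]"]) (use bound colspan_Nil in \<open>auto simp: less_Suc_eq_le\<close>)
  then obtain fs where fs: "set fs \<subseteq> fixed_vecs" "card (colspan v fs) = 2 ^ length fs"
    and fs_max: "\<And>gs. set gs \<subseteq> fixed_vecs \<Longrightarrow> card (colspan v gs) = 2 ^ length gs \<Longrightarrow> length gs \<le> length fs"
    by blast
  have F: "fixed_vecs \<subseteq> colspan v fs"
  proof (rule subsetI, rule ccontr)
    fix x assume "x \<in> fixed_vecs" "x \<notin> colspan v fs"
    then show False using fs_max[of "x # fs"] fs card_colspan_Cons fixed_vecs_carrier by simp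
  qed
  define bs where "bs us = concat (map (\<lambda>u. [u, s u]) us) @ fs" for us
  have bs_Cons: "bs (u # us) = u # s u # bs us" for u us by (simp add: bs_def)
  have len: "length (bs us) = 2 * length us + length fs" for us by (induction us) (auto simp: bs_def)
  have "\<exists>us. (set us \<subseteq> trace_kernel \<and> card (colspan v (bs us)) = 2 ^ (2 * length us + length fs)) \<and>
    (\<forall>ws. set ws \<subseteq> trace_kernel \<and> card (colspan v (bs ws)) = 2 ^ (2 * length ws + length fs) \<longrightarrow> length ws \<le> length us)"
  proof (rule ex_has_greatest_nat[where b = "Suc v" and k = "[]"])
    show "\<forall>ws. set ws \<subseteq> trace_kernel \<and> card (colspan v (bs ws)) = 2 ^ (2 * length ws + length fs) \<longrightarrow> length ws < Suc v"
      using bound by fastforce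
  qed (use fs in \<open>simp add: bs_def\<close>)
  then obtain us where us: "set us \<subseteq> trace_kernel" "card (colspan v (bs us)) = 2 ^ (2 * length us + length fs)"
    and us_max: "\<And>ws. set ws \<subseteq> trace_kernel \<Longrightarrow> card (colspan v (bs ws)) = 2 ^ (2 * length ws + length fs)
      \<Longrightarrow> length ws \<le> length us" by blast
  let ?W = "colspan v (bs us)"
  have inv: "s w \<in> ?W" if w: "w \<in> ?W" for w
  proof -
    obtain c where c: "c \<in> carrier_vec (length (bs us))" "w = mat_of_cols v (bs us) *\<^sub>v c"
      using w by (auto simp: colspan_def)
    then have "s w = mat_of_cols v (bs us) *\<^sub>v (blocks_mat (length us) (length fs) *\<^sub>v c)"
      using s_mat_of_cols_adapted[OF us(1) fs(1), of c] unfolding len by (simp add: bs_def)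
    moreover have "blocks_mat (length us) (length fs) *\<^sub>v c \<in> carrier_vec (length (bs us))"
      unfolding len by (rule mult_mat_vec_carrier[OF blocks_mat_carrier]) (use c len in simp)
    ultimately show ?thesis by (auto simp: colspan_def)
  qed
  have FW: "fixed_vecs \<subseteq> ?W"
  proof -
    have "set (concat (map (\<lambda>u. [u, s u]) us)) \<subseteq> carrier_vec v" using us(1) by (auto simp: trace_kernel_def)
    then show ?thesis using F colspan_append_subset[of _ v fs] unfolding bs_def by blast
  qed
  have "carrier_vec v \<subseteq> ?W"
  proof (rule subsetI, rule ccontr)
    fix x assume x: "x \<in> carrier_vec v" "x \<notin> ?W"
    \<comment> \<open>With this choice \<open>x + u\<close> is the trace of \<open>x\<close>, hence
      fixed and in the span, so \<open>u\<close> lies outside the span like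
      \<open>x\<close>.\<close>
    define u where "u = s x + s (s x)"
    have uU: "u \<in> trace_kernel" using add_s_in_trace_kernel[of "s x"] x by (simp add: u_def)
    then have uc: "u \<in> carrier_vec v" and u0: "u + s u + s (s u) = 0\<^sub>v v" by (auto simp: trace_kernel_def)
    have "s x + (s (s x) + x) = x + (s x + s (s x))"
      using x M by (intro eq_vecI) (auto simp: ac_simps)
    then have "x + u \<in> fixed_vecs" using x by (simp add: fixed_vecs_def u_def s_add)
    have uW: "u \<notin> ?W"
    proof
      assume "u \<in> ?W"
      then have "x + u + u \<in> ?W" using \<open>x + u \<in> fixed_vecs\<close> FW by (intro colspan_add[of "x + u"]) auto
      then show False using x(2) unfolding bit_vec_add_cancel(2)[OF uc x(1)] by simp
    qed
    \<comment> \<open>The span is invariant and \<open>s\<close> has cube 1, so with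
      \<open>u\<close> it also misses \<open>s u\<close> and \<open>s (s u) = u + s u\<close>. Hence
      \<open>u\<close> is not in the span enlarged by \<open>s u\<close>, and the pair
      \<open>u, s u\<close> extends the family, against maximality.\<close>
    have suW: "s u \<notin> ?W" using inv[of "s u"] inv[of "s (s u)"] uW uc by auto
    have "s (s u) \<notin> ?W" using inv[of "s (s u)"] uW uc by auto
    moreover have "s (s u) = u + s u" using u0 uc by (metis add_carrier_vec bit_vec_add_eq_0_iff s_carrier)
    ultimately have "u + s u \<notin> ?W" by simp
    moreover have "(s u + w) + s u = w" if "w \<in> ?W" for w
      using uc colspan_carrier[OF that] bit_vec_add_cancel(2)[of "s u" v w] comm_add_vec[of "s u" v w] by simp
    ultimately have "u \<noteq> s u + w" if "w \<in> ?W" for w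
      using that by metis
    then have "u \<notin> colspan v (s u # bs us)" using uW uc by (auto simp: colspan_Cons)
    then have "card (colspan v (bs (u # us))) = 2 ^ (2 * length (u # us) + length fs)"
      using suW uc us(2) by (simp add: bs_Cons card_colspan_Cons)
    then show False using us_max[of "u # us"] us(1) uU by simp
  qed
  then have W: "?W = carrier_vec v" using colspan_carrier by blast
  then have "2 * length us + length fs = v" using us(2) by (simp add: card_carrier_vec_bit)
  then show ?thesis using us(1) fs(1) W unfolding bs_def by blast
qed

lemma ex_similar_blocks_mat:
  "\<exists>k f P Q. 2 * k + f = v \<and> P \<in> carrier_mat v v \<and> Q \<in> carrier_mat v v \<and> P * Q = 1\<^sub>m v \<and> Q * P = 1\<^sub>m v
     \<and> M = P * blocks_mat k f * Q"
proof -
  obtain us fs where us: "set us \<subseteq> trace_kernel" and fs: "set fs \<subseteq> fixed_vecs" and v: "2 * length us + length fs = v"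
    and sp: "colspan v (concat (map (\<lambda>u. [u, s u]) us) @ fs) = carrier_vec v"
    using ex_adapted_basis by blast
  define C where "C = mat_of_cols v (concat (map (\<lambda>u. [u, s u]) us) @ fs)"
  let ?T = "blocks_mat (length us) (length fs)"
  have len: "length (concat (map (\<lambda>u. [u, s u]) us) @ fs) = v" unfolding v[symmetric] by (induction us) auto
  have C: "C \<in> carrier_mat v v" using mat_of_cols_carrier(1)[of v "concat (map (\<lambda>u. [u, s u]) us) @ fs"]
    unfolding C_def len .
  have T: "?T \<in> carrier_mat v v" using blocks_mat_carrier[of "length us" "length fs"] unfolding v .
  have img: "(\<lambda>c. C *\<^sub>v c) ` carrier_vec v = carrier_vec v" using sp unfolding colspan_def len C_def .
  \<comment> \<open>A surjection of a finite set onto itself is injective, so \<open>C\<close> has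
    trivial kernel and nonzero determinant.\<close>
  then have inj: "inj_on (\<lambda>c. C *\<^sub>v c) (carrier_vec v)"
    by (intro eq_card_imp_inj_on finite_carrier_vec_bit) simp
  have "det C \<noteq> 0"
  proof
    assume "det C = 0"
    then obtain c where c: "c \<in> carrier_vec v" "c \<noteq> 0\<^sub>v v" "C *\<^sub>v c = 0\<^sub>v v"
      using det_0_iff_vec_prod_zero_field[OF C] by blast
    moreover have "C *\<^sub>v 0\<^sub>v v = 0\<^sub>v v" using C by (intro eq_vecI) auto
    ultimately show False using inj_onD[OF inj, of c "0\<^sub>v v"] by simp
  qed
  from det_non_zero_imp_unit[OF C this, of "()"] obtain Q where Q: "Q \<in> carrier_mat v v" "C * Q = 1\<^sub>m v" "Q * C = 1\<^sub>m v"
    by (auto simp: Units_def ring_mat_simps)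
  have unit: "X *\<^sub>v unit_vec v j = col X j" if "X \<in> carrier_mat v v" "j < v" for X :: "bit mat" and j
    using that col_mult2[OF that(1) one_carrier_mat that(2)] by simp
  \<comment> \<open>Column \<open>j\<close> of each product is the image of the unit vector with
    index \<open>j\<close>, to which the coordinate formula applies.\<close>
  have MC: "M * C = C * ?T"
  proof (rule mat_col_eqI)
    fix j assume "j < dim_col (C * ?T)"
    then have j: "j < v" using T by simp
    have "s (C *\<^sub>v unit_vec v j) = C *\<^sub>v (?T *\<^sub>v unit_vec v j)"
      using s_mat_of_cols_adapted[OF us fs, of "unit_vec v j"] unfolding v C_def by simp
    then show "col (M * C) j = col (C * ?T) j"
      unfolding col_mult2[OF M C j] col_mult2[OF C T j] unit[OF C j] unit[OF T j] .
  qed (use M C T in auto)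
  have "M = M * (C * Q)" using M Q by simp
  also have "\<dots> = C * ?T * Q" unfolding assoc_mult_mat[OF M C Q(1), symmetric] MC ..
  finally show ?thesis using v C Q by blast
qed

end

section \<open>The type of an automorphism\<close>

text \<open>Transposition reverses the product \<open>A * A * A\<close> of equal factors, so the
  transpose has cube 1 too.\<close>

lemma order3_of_GL2:
  assumes A: "A \<in> carrier (GL2 v)" and ord: "group.ord (GL2 v) A = 3"
  shows "order3 v (transpose_mat A)" "A \<in> carrier_mat v v" "A \<noteq> 1\<^sub>m v"
proof -
  interpret R: ring "ring_mat TYPE(bit) v ()" by (rule ring_mat)
  interpret G: group "GL2 v" unfolding GL2_def by (rule R.units_group)
  show Ac: "A \<in> carrier_mat v v"
    using A by (auto simp: GL2_def units_of_def Units_def ring_mat_simps)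
  have mult: "mult (GL2 v) = (*)" and one: "one (GL2 v) = 1\<^sub>m v"
    by (auto simp: GL2_def units_of_def ring_mat_simps)
  have "A [^]\<^bsub>GL2 v\<^esub> (3::nat) = 1\<^sub>m v" using G.pow_ord_eq_1[OF A] ord one by simp
  then have "A * A * A = 1\<^sub>m v"
    using Ac by (simp add: numeral_3_eq_3 mult one)
  then have "transpose_mat (A * A * A) = 1\<^sub>m v" by simp
  then have "transpose_mat A * transpose_mat A * transpose_mat A = 1\<^sub>m v"
    using Ac by (simp add: transpose_mult[where nr = v and n = v and nc = v] assoc_mult_mat[where ?n\<^sub>1 = v])
  then show "order3 v (transpose_mat A)" using Ac by unfold_locales auto
  show "A \<noteq> 1\<^sub>m v" using G.ord_eq_1[OF A] ord one by auto
qed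

lemma ex_has_type:
  assumes "order3 v (transpose_mat A)" "A \<in> carrier_mat v v" "A \<noteq> 1\<^sub>m v"
  shows "\<exists>f. has_type v A f"
proof -
  interpret order3 v "transpose_mat A" by fact
  obtain k f P Q where v: "2 * k + f = v" and P: "P \<in> carrier_mat v v" and Q: "Q \<in> carrier_mat v v"
    and PQ: "P * Q = 1\<^sub>m v" "Q * P = 1\<^sub>m v" and A: "transpose_mat A = P * blocks_mat k f * Q"
    using ex_similar_blocks_mat by blast
  let ?T = "blocks_mat k f"
  have T: "?T \<in> carrier_mat v v" using blocks_mat_carrier[of k f] unfolding v .
  have type: "type_mat v f = ?T" using v by (auto simp: type_mat_def blocks_mat_def)
  have "A = transpose_mat (P * ?T * Q)" unfolding A[symmetric] by simp
  also have "\<dots> = transpose_mat Q * (transpose_mat ?T * transpose_mat P)"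
    by (simp add: transpose_mult[OF mult_carrier_mat[OF P T] Q] transpose_mult[OF P T])
  also have "\<dots> = transpose_mat Q * ?T * transpose_mat P"
    unfolding transpose_blocks_mat using P Q T by (intro assoc_mult_mat[symmetric]) auto
  finally have AT: "A = transpose_mat Q * ?T * transpose_mat P" .
  have QP: "transpose_mat Q * transpose_mat P = 1\<^sub>m v" "transpose_mat P * transpose_mat Q = 1\<^sub>m v"
    using PQ by (simp_all flip: transpose_mult[OF P Q] transpose_mult[OF Q P])
  have "similar_mat A ?T"
    by (rule similar_matI[of _ _ "transpose_mat Q" "transpose_mat P" v]) (use assms(2) P Q T QP AT in auto)
  moreover have "f \<noteq> v"
  \<comment> \<open>Without any 2 by 2 block the normal form is the identity, and so is its
    conjugate \<open>A\<close>.\<close>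
  proof
    assume "f = v"
    then have "k = 0" using v by simp
    then have "A = 1\<^sub>m v" using AT QP(1) Q \<open>f = v\<close> by (simp add: blocks_mat_0)
    then show False using assms(3) by simp
  qed
  ultimately show ?thesis unfolding has_type_def using v type by (intro exI[of _ f] conjI) auto
qed

text \<open>The transpose of the conjugating matrix \<open>P\<close> maps the fixed vectors
  bijectively onto those of the normal form. Starting from an arbitrary type makes the constraints
  hold for every \<open>f\<close> with \<open>has_type v A f\<close>.\<close>

lemma card_fixed_if_has_type:
  assumes A: "A \<in> carrier_mat v v" and f: "has_type v A f"
  shows "card {x \<in> carrier_vec v. transpose_mat A *\<^sub>v x = x} = 2 ^ f"
proof -
  define k where "k = (v - f) div 2"
  have v: "2 * k + f = v" using f by (auto simp: has_type_def k_def)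
  let ?T = "blocks_mat k f"
  have T: "?T \<in> carrier_mat v v" using blocks_mat_carrier[of k f] unfolding v .
  have "similar_mat A ?T" using f by (simp add: has_type_def type_mat_def blocks_mat_def k_def)
  then obtain P Q where "similar_mat_wit A ?T P Q" by (auto simp: similar_mat_def)
  from similar_mat_witD2[OF A this] have P: "P \<in> carrier_mat v v" and Q: "Q \<in> carrier_mat v v"
    and PQ: "P * Q = 1\<^sub>m v" "Q * P = 1\<^sub>m v" and AT: "A = P * ?T * Q" by auto
  let ?P = "transpose_mat P" and ?Q = "transpose_mat Q"
  have Pc: "?P \<in> carrier_mat v v" and Qc: "?Q \<in> carrier_mat v v" using P Q by auto
  have QP: "?Q * ?P = 1\<^sub>m v" "?P * ?Q = 1\<^sub>m v"
    using PQ by (simp_all flip: transpose_mult[OF P Q] transpose_mult[OF Q P])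
  have AT': "transpose_mat A = ?Q * (?T * ?P)"
    unfolding AT by (simp add: transpose_mult[OF mult_carrier_mat[OF P T] Q] transpose_mult[OF P T] transpose_blocks_mat)
  have act: "transpose_mat A *\<^sub>v x = ?Q *\<^sub>v (?T *\<^sub>v (?P *\<^sub>v x))" if "x \<in> carrier_vec v" for x
    unfolding AT' using that Pc Qc T by (simp add: assoc_mult_mat_vec[where n\<^sub>1 = v and n\<^sub>2 = v and n\<^sub>3 = v])
  have PQx: "?P *\<^sub>v (?Q *\<^sub>v x) = x" "?Q *\<^sub>v (?P *\<^sub>v x) = x" if "x \<in> carrier_vec v" for x
    using that Pc Qc QP by (simp_all flip: assoc_mult_mat_vec[where n\<^sub>1 = v and n\<^sub>2 = v and n\<^sub>3 = v])
  have cl: "?P *\<^sub>v x \<in> carrier_vec v" "?Q *\<^sub>v x \<in> carrier_vec v" "?T *\<^sub>v x \<in> carrier_vec v"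
    if "x \<in> carrier_vec v" for x
    using that Pc Qc T by (auto intro!: mult_mat_vec_carrier)
  have "bij_betw (\<lambda>x. ?P *\<^sub>v x) {x \<in> carrier_vec v. transpose_mat A *\<^sub>v x = x}
    {c \<in> carrier_vec v. ?T *\<^sub>v c = c}"
  proof (rule bij_betwI[where g = "\<lambda>x. ?Q *\<^sub>v x"])
    show "(\<lambda>x. ?P *\<^sub>v x) \<in> {x \<in> carrier_vec v. transpose_mat A *\<^sub>v x = x} \<rightarrow> {c \<in> carrier_vec v. ?T *\<^sub>v c = c}"
    proof clarify
      fix x assume x: "x \<in> carrier_vec v" "transpose_mat A *\<^sub>v x = x"
      have "?P *\<^sub>v (?Q *\<^sub>v (?T *\<^sub>v (?P *\<^sub>v x))) = ?P *\<^sub>v x" using act x by simp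
      then show "?P *\<^sub>v x \<in> carrier_vec v \<and> ?T *\<^sub>v (?P *\<^sub>v x) = ?P *\<^sub>v x"
        using cl x PQx by simp
    qed
    show "(\<lambda>x. ?Q *\<^sub>v x) \<in> {c \<in> carrier_vec v. ?T *\<^sub>v c = c} \<rightarrow> {x \<in> carrier_vec v. transpose_mat A *\<^sub>v x = x}"
      using act cl PQx by auto
  qed (use PQx in auto)
  then show ?thesis using card_fixed_blocks_mat[of k f] unfolding v by (simp add: bij_betw_same_card)
qed

lemma sts_order3_of_automorphism:
  assumes D: "STS2 v D" and aut: "automorphism v D A" and o3: "order3 v (transpose_mat A)"
  shows "sts_order3 v (transpose_mat A) D"
proof -
  interpret order3 v "transpose_mat A" by fact
  have blk: "B \<subseteq> carrier_vec v \<and> 0\<^sub>v v \<in> B \<and> (\<forall>x\<in>B. \<forall>y\<in>B. x + y \<in> B) \<and> card B = 8" if "B \<in> D" for B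
  proof -
    have "B \<in> subspaces_of_dim v 3" using D that by (auto simp: STS2_def)
    then show ?thesis unfolding subspaces_of_dim_iff by simp
  qed
  \<comment> \<open>The line through \<open>x\<close> and \<open>y\<close> consists of these four
    vectors, and a block contains it exactly if it contains \<open>x\<close> and
    \<open>y\<close>.\<close>
  have line: "\<exists>!B. B \<in> D \<and> {0\<^sub>v v, x, y, x + y} \<subseteq> B"
    if xy: "x \<in> carrier_vec v" "y \<in> carrier_vec v" "x \<noteq> 0\<^sub>v v" "y \<noteq> 0\<^sub>v v" "x \<noteq> y" for x y
  proof -
    have "card {0\<^sub>v v, x, y, x + y} = 2 ^ 2" using card_bit_line[OF xy] by simp
    moreover have "\<forall>a\<in>{0\<^sub>v v, x, y, x + y}. \<forall>b\<in>{0\<^sub>v v, x, y, x + y}. a + b \<in> {0\<^sub>v v, x, y, x + y}"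
      using xy bit_vec_add_cancel[of x v y] bit_vec_add_cancel[of y v x] comm_add_vec[of x v y]
      by (auto simp: bit_vec_add_self)
    ultimately have ls: "{0\<^sub>v v, x, y, x + y} \<in> subspaces_of_dim v 2"
      unfolding subspaces_of_dim_iff using xy by (intro conjI) auto
    have all: "\<forall>L\<in>subspaces_of_dim v 2. \<exists>!B. B \<in> D \<and> L \<subseteq> B" using D by (simp add: STS2_def)
    show ?thesis using bspec[OF all ls] .
  qed
  have line_iff: "{0\<^sub>v v, x, y, x + y} \<subseteq> B \<longleftrightarrow> x \<in> B \<and> y \<in> B" if "B \<in> D" for B x y
    using blk[OF that] by auto
  show ?thesis
  proof unfold_locales
    show "B \<subseteq> carrier_vec v \<and> 0\<^sub>v v \<in> B \<and> card B = 8" if "B \<in> D" for B using blk[OF that] by blast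
    show "x + y \<in> B" if "B \<in> D" "x \<in> B" "y \<in> B" for B x y using blk[OF that(1)] that by blast
    show "\<exists>B\<in>D. x \<in> B \<and> y \<in> B" if "x \<in> carrier_vec v" "y \<in> carrier_vec v" "x \<noteq> 0\<^sub>v v" "y \<noteq> 0\<^sub>v v" "x \<noteq> y" for x y
      using line[OF that] by auto
    show "B = C" if h: "B \<in> D" "C \<in> D" "x \<in> B" "x \<in> C" "y \<in> B" "y \<in> C" "x \<noteq> 0\<^sub>v v" "y \<noteq> 0\<^sub>v v" "x \<noteq> y"
      for B C x y
    proof -
      have "x \<in> carrier_vec v" "y \<in> carrier_vec v" using blk[OF h(1)] h by auto
      from line[OF this h(7-9)] show ?thesis using h line_iff[of B x y] line_iff[of C x y] by blast
    qed
    show "s ` B \<in> D" if "B \<in> D" for B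
      using aut that by (auto simp: automorphism_def act_def row_mult_def)
  qed
qed

theorem theorem10:
  fixes v :: nat and D :: "bit vec set set" and A :: "bit mat"
  assumes "STS2 v D"
    and "automorphism v D A"
    and "group.ord (GL2 v) A = 3"
  shows "(\<exists>f. has_type v A f) \<and>
    (\<forall>f. has_type v A f \<longrightarrow>
       f mod 3 \<noteq> 2 \<and>
       (f mod 3 \<noteq> v mod 3 \<longrightarrow> v = 3 \<or> real f \<le> (real v - 3) / 2))"
proof -
  have GL: "A \<in> carrier (GL2 v)" using assms(2) by (simp add: automorphism_def)
  note A = order3_of_GL2[OF GL assms(3)]
  interpret sts_order3 v "transpose_mat A" D
    by (rule sts_order3_of_automorphism[OF assms(1,2) A(1)])
  have "f mod 3 \<noteq> 2 \<and> (f mod 3 \<noteq> v mod 3 \<longrightarrow> v = 3 \<or> real f \<le> (real v - 3) / 2)"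
    if f: "has_type v A f" for f
  proof -
    have "card fixed_vecs = 2 ^ f" unfolding fixed_vecs_def by (rule card_fixed_if_has_type[OF A(2) f])
    moreover have "f < v" "even (v - f)" using f by (auto simp: has_type_def)
    ultimately have c: "f mod 3 \<noteq> 2" "f mod 3 \<noteq> v mod 3 \<Longrightarrow> v \<noteq> 3 \<Longrightarrow> 2 * f + 3 \<le> v"
      using fixed_dim_constraints by blast+
    have "real f \<le> (real v - 3) / 2" if "2 * f + 3 \<le> v"
      using of_nat_mono[OF that, where 'a = real] by simp
    then show ?thesis using c by blast
  qed
  then show ?thesis using ex_has_type[OF A] by blast
qed

end
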